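(* Let $n\ge 2$ be an integer and let $\lambda\in[0,1]$. Then $$\sum_{j=0}^{n}\lambda^j-\sum_{k=1}^{n-1}\left\{M\left(\left[\frac{n-1}{k}\right]\right)\left(\sum_{j=0}^{n-k}\lambda^j\right)\right\}\ \ge\ 0,$$ and equality occurs if and only if $\lambda=0$.
   Context: Here $\mu$ denotes the Möbius function on the positive integers: $\mu(1)=1$; $\mu(m)=0$ if $m$ is divisible by the square of an integer greater than $1$; and $\mu(m)=(-1)^r$ if $m$ is the product of $r$ pairwise distinct primes. The Mertens function is $M(N)=\sum_{m=1}^{N}\mu(m)$ for positive integers $N$. For positive integers $a,k$ with $k\le a$, $\left[\frac{a}{k}\right]$ denotes the largest integer $j$ with $j\le \frac{a}{k}$ (the floor). The convention $\lambda^0=1$ is used, including at $\lambda=0$. *)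

theory Defs
  imports Complex_Main "HOL-Computational_Algebra.Squarefree"
begin

(* The junk value at 0 is 0, since 0 is not squarefree. *)
definition moebius :: "nat \<Rightarrow> int" where
  "moebius m = (if squarefree m then (- 1) ^ card (prime_factors m) else 0)"

definition mertens :: "nat \<Rightarrow> int" where
  "mertens N = (\<Sum>m = 1..N. moebius m)"

end

theory Submission
  imports Defs
begin

text \<open>
  Exchanging sums turns \<open>\<Sum>k\<le>N. M(N div k) F(k)\<close> into the sum over \<open>m \<le> N\<close> of the Dirichlet
  convolutions \<open>(\<mu> * F)(m)\<close>. For \<open>F = 1\<close> this gives \<open>\<Sum>k\<le>N. M(N div k) = 1\<close>, so with \<open>N = n - 1\<close> the
  expression of the theorem equals \<open>\<Sum>k\<le>N. M(N div k) F(k)\<close> for \<open>F(k) = \<lambda>^(n-k+1) + \<dots> + \<lambda>^n\<close>.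
  If \<open>0 < \<lambda> < 1\<close> and \<open>s = - ln \<lambda>\<close>, then \<open>(1 - \<lambda>) F(k) = \<lambda>^(n+1) (exp (s k) - 1)\<close>, which is a power series
  in \<open>k\<close> with positive coefficients; the convolution of \<open>\<mu>\<close> with \<open>k ^ r\<close> is the Jordan totient,
  positive for \<open>r > 0\<close>. If \<open>\<lambda> = 1\<close>, then \<open>F(k) = k\<close>, and if \<open>\<lambda> = 0\<close>, then \<open>F = 0\<close>.
\<close>

lemma prime_factors_prod_primes:
  fixes P :: "nat set"
  assumes "finite P" "\<And>p. p \<in> P \<Longrightarrow> prime p"
  shows "prime_factors (\<Prod>P) = P"
proof -
  have "0 \<notin> P" using assms(2)[of 0] by auto
  then show ?thesis
    using assms by (subst prime_factors_prod) (auto simp: prime_prime_factors)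
qed

lemma prod_prime_factors_squarefree:
  fixes d :: nat
  assumes "squarefree d"
  shows "\<Prod>(prime_factors d) = d"
proof -
  have "d \<noteq> 0" using assms by (metis not_squarefree_0)
  then have "d = (\<Prod>p\<in>prime_factors d. p ^ multiplicity p d)"
    by (intro prime_factorization_nat) simp
  also have "\<dots> = \<Prod>(prime_factors d)"
    using assms \<open>d \<noteq> 0\<close> by (intro prod.cong) (auto simp: squarefree_factorial_semiring')
  finally show ?thesis ..
qed

text \<open>Expanding the product on the right gives one term per set \<open>P\<close> of prime
  factors of \<open>m\<close>. Such sets correspond to squarefree divisors through \<open>P\<close>
  \<mapsto> \<open>\<Prod>P\<close>, and the sign of the term is the Moebius value.\<close>

lemma sum_moebius_mult_dvd:
  fixes g :: "nat \<Rightarrow> real"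
  assumes m: "m > 0" and g1: "g 1 = 1" and gm: "\<And>a b. g (a * b) = g a * g b"
  shows "(\<Sum>d | d dvd m. of_int (moebius d) * g d) = (\<Prod>p\<in>prime_factors m. 1 - g p)"
proof -
  have g_prod: "g (\<Prod>P) = (\<Prod>p\<in>P. g p)" if "finite P" for P
    using that by (induction P) (simp_all add: g1[simplified] gm)
  have "(\<Prod>p\<in>prime_factors m. 1 - g p) = (\<Prod>p\<in>prime_factors m. - g p + 1)"
    by simp
  also have "\<dots> = (\<Sum>P\<in>Pow (prime_factors m). \<Prod>p\<in>P. - g p)"
    by (subst prod_add) simp_all
  also have "\<dots> = (\<Sum>d | d dvd m \<and> squarefree d. of_int (moebius d) * g d)"
  proof (rule sum.reindex_bij_witness[of _ prime_factors Prod])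
    fix P assume P: "P \<in> Pow (prime_factors m)"
    then have fin: "finite P" and pr: "\<And>p. p \<in> P \<Longrightarrow> prime p"
      by (auto intro: finite_subset)
    show pf: "prime_factors (\<Prod>P) = P"
      by (rule prime_factors_prod_primes[OF fin pr])
    have sf: "squarefree (\<Prod>P)"
      using pr by (intro squarefree_prod_coprime) (auto intro: primes_coprime squarefree_prime)
    have "\<Prod>P dvd \<Prod>(prime_factors m)"
      using P by (intro prod_dvd_prod_subset) auto
    also have "\<dots> dvd (\<Prod>p\<in>prime_factors m. p ^ multiplicity p m)"
      by (intro prod_dvd_prod) (auto intro!: dvd_power simp: prime_factors_multiplicity)
    also have "\<dots> = m" using m by (simp add: prime_factorization_nat[symmetric])
    finally show "\<Prod>P \<in> {d. d dvd m \<and> squarefree d}" using sf by simp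
    show "of_int (moebius (\<Prod>P)) * g (\<Prod>P) = (\<Prod>p\<in>P. - g p)"
      using sf by (simp add: moebius_def pf g_prod[OF fin] prod_uminus)
  next
    fix d assume d: "d \<in> {d. d dvd m \<and> squarefree d}"
    then show "\<Prod>(prime_factors d) = d" by (simp add: prod_prime_factors_squarefree)
    show "prime_factors d \<in> Pow (prime_factors m)"
      using d m by (auto intro: dvd_prime_factors[THEN subsetD, rotated])
  qed
  \<comment> \<open>The divisors added back are not squarefree, so \<open>moebius\<close> is 0
    there.\<close>
  also have "\<dots> = (\<Sum>d | d dvd m. of_int (moebius d) * g d)"
    using m by (intro sum.mono_neutral_left) (auto simp: moebius_def)
  finally show ?thesis ..
qed

text \<open>Replace \<open>k\<close> by the complementary divisor \<open>d = m div k\<close>, pull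
  out \<open>real m ^ r\<close>, and use the completely multiplicative function
  \<open>g d = 1 / real d ^ r\<close>.\<close>

lemma sum_moebius_power:
  assumes m: "m > 0"
  shows "(\<Sum>k | k dvd m. of_int (moebius (m div k)) * real k ^ r)
           = real m ^ r * (\<Prod>p\<in>prime_factors m. 1 - 1 / real p ^ r)"
proof -
  have "(\<Sum>k | k dvd m. of_int (moebius (m div k)) * real k ^ r)
      = (\<Sum>d | d dvd m. of_int (moebius d) * real (m div d) ^ r)"
    using m by (intro sum.reindex_bij_witness[of _ "\<lambda>d. m div d" "\<lambda>d. m div d"]) auto
  also have "\<dots> = real m ^ r * (\<Sum>d | d dvd m. of_int (moebius d) * (1 / real d ^ r))"
    unfolding sum_distrib_left by (intro sum.cong) (auto simp: real_of_nat_div power_divide)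
  also have "(\<Sum>d | d dvd m. of_int (moebius d) * (1 / real d ^ r))
      = (\<Prod>p\<in>prime_factors m. 1 - 1 / real p ^ r)"
    using m by (intro sum_moebius_mult_dvd) (auto simp: power_mult_distrib)
  finally show ?thesis .
qed

lemma sum_moebius_power_pos:
  assumes "m > 0" "r > 0"
  shows "(\<Sum>k | k dvd m. of_int (moebius (m div k)) * real k ^ r) > 0"
proof -
  have "1 - 1 / real p ^ r > 0" if "p \<in> prime_factors m" for p
  proof -
    have "real p > 1" using that prime_gt_1_nat[of p] by (simp add: in_prime_factors_iff)
    then show ?thesis using \<open>r > 0\<close> by simp
  qed
  then show ?thesis
    unfolding sum_moebius_power[OF \<open>m > 0\<close>] using \<open>m > 0\<close>
    by (intro mult_pos_pos prod_pos) auto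
qed

text \<open>This is the case \<open>r = 0\<close>: every factor 1 - 1 / p^0 is 0, so the product is
  nonzero only when it is empty.\<close>

lemma sum_moebius:
  assumes "m > 0"
  shows "(\<Sum>k | k dvd m. of_int (moebius (m div k))) = (if m = 1 then 1 else 0 :: real)"
proof -
  have "prime_factors m \<noteq> {}" if "m \<noteq> 1"
    using assms that by (simp add: prime_factorization_empty_iff)
  then show ?thesis using sum_moebius_power[OF assms, of 0] by (simp add: prod_zero_iff card_gt_0_iff)
qed

text \<open>Subtracting 1 removes the constant term of the exponential series. Only exponents
  \<open>Suc r\<close> remain, and for these the convolution with \<open>moebius\<close> is strictly
  positive.\<close>

lemma sum_moebius_exp_pos:
  fixes s :: real
  assumes m: "m > 0" and s: "s > 0"
  shows "(\<Sum>k | k dvd m. of_int (moebius (m div k)) * (exp (s * real k) - 1)) > 0"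
proof -
  define J where "J r = (\<Sum>k | k dvd m. of_int (moebius (m div k)) * real k ^ Suc r)" for r
  have exp_sums: "(\<lambda>r. (s * real k) ^ Suc r / fact (Suc r)) sums (exp (s * real k) - 1)" for k
    using exp_converges[of "s * real k"]
    by (subst sums_Suc_iff) (simp add: divide_inverse mult.commute scaleR_conv_of_real)
  have "(\<lambda>r. \<Sum>k | k dvd m. of_int (moebius (m div k)) * ((s * real k) ^ Suc r / fact (Suc r)))
      sums (\<Sum>k | k dvd m. of_int (moebius (m div k)) * (exp (s * real k) - 1))"
    by (intro sums_sum sums_mult exp_sums)
  also have "(\<lambda>r. \<Sum>k | k dvd m. of_int (moebius (m div k)) * ((s * real k) ^ Suc r / fact (Suc r)))
      = (\<lambda>r. s ^ Suc r / fact (Suc r) * J r)"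
    unfolding J_def sum_distrib_left
    by (intro ext sum.cong) (simp_all add: power_mult_distrib field_simps del: fact_Suc power_Suc)
  finally have sums: "(\<lambda>r. s ^ Suc r / fact (Suc r) * J r)
      sums (\<Sum>k | k dvd m. of_int (moebius (m div k)) * (exp (s * real k) - 1))" .
  have "s ^ Suc r / fact (Suc r) * J r > 0" for r
    unfolding J_def using m s by (intro mult_pos_pos divide_pos_pos sum_moebius_power_pos) auto
  then show ?thesis
    unfolding sums_unique[OF sums] by (rule suminf_pos[OF sums_summable[OF sums]])
qed

text \<open>Both sides sum over the pairs \<open>(k, l)\<close> with \<open>k * l \<le> N\<close>:
  the left groups them by \<open>k\<close>, the right by the product
  \<open>m = k * l\<close>.\<close>

lemma sum_mertens:
  fixes F :: "nat \<Rightarrow> real"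
  shows "(\<Sum>k = 1..N. of_int (mertens (N div k)) * F k)
           = (\<Sum>m = 1..N. \<Sum>k | k dvd m. of_int (moebius (m div k)) * F k)"
proof -
  have "(\<Sum>k = 1..N. of_int (mertens (N div k)) * F k)
      = (\<Sum>(k, l) \<in> (SIGMA k:{1..N}. {1..N div k}). of_int (moebius l) * F k)"
    by (simp add: mertens_def sum_distrib_right sum.Sigma)
  also have "\<dots> = (\<Sum>(m, k) \<in> (SIGMA m:{1..N}. {k. k dvd m}). of_int (moebius (m div k)) * F k)"
  proof (rule sum.reindex_bij_witness[of _ "\<lambda>(m, k). (k, m div k)" "\<lambda>(k, l). (k * l, k)"])
    fix x assume "x \<in> (SIGMA k:{1..N}. {1..N div k})"
    then show "(case case x of (k, l) \<Rightarrow> (k * l, k) of (m, k) \<Rightarrow> (k, m div k)) = x"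
      and "(case x of (k, l) \<Rightarrow> (k * l, k)) \<in> (SIGMA m:{1..N}. {k. k dvd m})"
      and "(case case x of (k, l) \<Rightarrow> (k * l, k) of (m, k) \<Rightarrow> of_int (moebius (m div k)) * F k)
             = (case x of (k, l) \<Rightarrow> of_int (moebius l) * F k)"
      by (auto simp: less_eq_div_iff_mult_less_eq mult.commute)
  next
    fix x assume x: "x \<in> (SIGMA m:{1..N}. {k. k dvd m})"
    then obtain m k where mk: "x = (m, k)" "1 \<le> m" "m \<le> N" "k dvd m" by auto
    then have "1 \<le> k" "k \<le> m" "1 \<le> m div k" "m div k \<le> N div k"
      by (auto simp: Suc_le_eq dvd_div_eq_0_iff div_greater_zero_iff
               intro: dvd_pos_nat dvd_imp_le div_le_mono)
    then show "(case case x of (m, k) \<Rightarrow> (k, m div k) of (k, l) \<Rightarrow> (k * l, k)) = x"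
      and "(case x of (m, k) \<Rightarrow> (k, m div k)) \<in> (SIGMA k:{1..N}. {1..N div k})"
      using mk by auto
  qed
  also have "\<dots> = (\<Sum>m = 1..N. \<Sum>k | k dvd m. of_int (moebius (m div k)) * F k)"
    by (subst sum.Sigma) auto
  finally show ?thesis .
qed

lemma sum_mertens_one:
  assumes "N > 0"
  shows "(\<Sum>k = 1..N. real_of_int (mertens (N div k))) = 1"
proof -
  have "(\<Sum>k = 1..N. real_of_int (mertens (N div k))) = (\<Sum>m = 1..N. if m = 1 then 1 else 0)"
    using sum_mertens[of N "\<lambda>_. 1"] by (simp add: sum_moebius)
  then show ?thesis using assms by simp
qed

lemma sum_moebius_geometric_pos:
  fixes lam :: real
  assumes m: "m > 0" "m \<le> n" and lam: "0 < lam" "lam \<le> 1"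
  shows "(\<Sum>k | k dvd m. of_int (moebius (m div k)) * (\<Sum>j = Suc (n - k)..n. lam ^ j)) > 0"
    (is "?S > 0")
proof (cases "lam = 1")
  \<comment> \<open>Dividing by \<open>1 - lam\<close> is impossible here, but the inner sum just
    counts its \<open>k\<close> terms.\<close>
  case True
  have "?S = (\<Sum>k | k dvd m. of_int (moebius (m div k)) * real k ^ 1)"
    using m True by (intro sum.cong) (auto dest: dvd_imp_le)
  then show ?thesis using sum_moebius_power_pos[OF m(1), of 1] by simp
next
  case False
  define s where "s = - ln lam"
  have "s > 0" using lam False by (simp add: s_def)
  have geo: "(1 - lam) * (\<Sum>j = Suc (n - k)..n. lam ^ j) = lam ^ Suc n * (exp (s * real k) - 1)"
    if "k dvd m" for k
  proof -
    have "k \<le> n" using that m by (meson dvd_imp_le le_trans)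
    have "exp (s * real k) = 1 / lam ^ k"
      using lam by (simp add: s_def exp_minus exp_of_nat2_mult inverse_eq_divide power_divide)
    then have "lam ^ Suc n * exp (s * real k) = lam ^ (Suc n - k)"
      using lam \<open>k \<le> n\<close> by (simp add: power_diff)
    \<comment> \<open>For \<open>k = 0\<close> the range of summation is empty and the two powers
      cancel; otherwise it is nonempty, as the closed formula requires.\<close>
    moreover have "(1 - lam) * (\<Sum>j = Suc (n - k)..n. lam ^ j) = lam ^ Suc (n - k) - lam ^ Suc n"
      using \<open>k \<le> n\<close> by (cases "k = 0") (simp_all add: sum_gp_multiplied)
    ultimately show ?thesis
      using \<open>k \<le> n\<close> by (simp only: right_diff_distrib Suc_diff_le mult_1_right)
  qed
  have "(1 - lam) * ?S
      = (\<Sum>k | k dvd m. of_int (moebius (m div k)) * ((1 - lam) * (\<Sum>j = Suc (n - k)..n. lam ^ j)))"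
    by (simp add: sum_distrib_left mult.left_commute)
  also have "\<dots> = lam ^ Suc n * (\<Sum>k | k dvd m. of_int (moebius (m div k)) * (exp (s * real k) - 1))"
    by (simp only: sum_distrib_left[of "lam ^ Suc n"])
       (intro sum.cong, simp_all only: geo mem_Collect_eq mult.left_commute)
  also have "\<dots> > 0"
    using sum_moebius_exp_pos[OF m(1) \<open>s > 0\<close>] lam by simp
  finally show ?thesis
    using lam False by (simp add: zero_less_mult_iff)
qed

theorem theorem1p1:
  fixes n :: nat and lam :: real
  assumes "n \<ge> 2" and "0 \<le> lam" and "lam \<le> 1"
  shows "(\<Sum>j = 0..n. lam ^ j)
           - (\<Sum>k = 1..n - 1. real_of_int (mertens ((n - 1) div k)) * (\<Sum>j = 0..n - k. lam ^ j)) \<ge> 0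
       \<and> ((\<Sum>j = 0..n. lam ^ j)
           - (\<Sum>k = 1..n - 1. real_of_int (mertens ((n - 1) div k)) * (\<Sum>j = 0..n - k. lam ^ j)) = 0
          \<longleftrightarrow> lam = 0)"
    (is "?E \<ge> 0 \<and> (?E = 0 \<longleftrightarrow> lam = 0)")
proof -
  define c where "c k = real_of_int (mertens ((n - 1) div k))" for k
  define F where "F k = (\<Sum>j = Suc (n - k)..n. lam ^ j)" for k
  \<comment> \<open>As the weights add up to 1, the full geometric sum can be moved under the sum
    over \<open>k\<close>, where only its top powers \<open>F k\<close> survive.\<close>
  have "(\<Sum>k = 1..n - 1. c k) = 1"
    unfolding c_def using assms(1) by (intro sum_mertens_one) simp
  then have "?E = (\<Sum>k = 1..n - 1. c k * ((\<Sum>j = 0..n. lam ^ j) - (\<Sum>j = 0..n - k. lam ^ j)))"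
    by (simp add: right_diff_distrib sum_subtractf sum_distrib_right[symmetric] c_def)
  also have "\<dots> = (\<Sum>k = 1..n - 1. c k * F k)"
  proof (intro sum.cong refl arg_cong2[where f = "(*)"])
    fix k
    show "(\<Sum>j = 0..n. lam ^ j) - (\<Sum>j = 0..n - k. lam ^ j) = F k"
      using sum.ub_add_nat[of 0 "n - k" "\<lambda>j. lam ^ j" "n - (n - k)"] by (simp add: F_def)
  qed
  finally have E: "?E = (\<Sum>k = 1..n - 1. c k * F k)" .
  show ?thesis
  proof (cases "lam = 0")
    case True
    \<comment> \<open>All exponents in \<open>F k\<close> are at least 1, so the convention 0^0 = 1
      does not enter.\<close>
    then have "F k = 0" for k by (simp add: F_def power_0_left)
    then show ?thesis using E True by simp
  next
    case False
    have "(\<Sum>k = 1..n - 1. c k * F k)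
        = (\<Sum>m = 1..n - 1. \<Sum>k | k dvd m. of_int (moebius (m div k)) * F k)"
      unfolding c_def by (rule sum_mertens)
    \<comment> \<open>Strictness needs a nonempty range of \<open>m\<close>, which
      \<open>n \<ge> 2\<close> provides.\<close>
    also have "\<dots> > 0"
      unfolding F_def using assms False
      by (intro sum_pos sum_moebius_geometric_pos) auto
    finally show ?thesis using E False by simp
  qed
qed

end
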